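(* Let $p>2$. There are constants $c,C>0$ depending only on $p$ such that for every sufficiently small $\varepsilon>0$ and every $n\ge C d/\varepsilon^p$ the following holds. Any randomized algorithm that, given $A\in\mathbb{R}^{n\times d}$, query access to the entries of an unknown $b\in\mathbb{R}^n$, and $f\in\mathsf{Lip}_1$, outputs $\hat x\in\mathbb{R}^d$ such that, for every such input, with probability at least $4/5$, $$\|f(A\hat x)-b\|_p^p\le \mathsf{OPT}+\varepsilon\big(\mathsf{OPT}+\|Ax^*\|_p^p\big),$$ must, on some input, make at least $c\,d/\varepsilon^p$ queries to the entries of $b$.
   Context: $\mathsf{Lip}_1$ is the set of $f:\mathbb{R}\to\mathbb{R}$ with $f(0)=0$ and $|f(x)-f(y)|\le|x-y|$; $f$ is applied entrywise to vectors. $\mathsf{OPT}:=\min_{x\in\mathbb{R}^d}\|f(Ax)-b\|_p^p$ and $x^*$ is a minimizer of $\|Ax\|_p^p$ among all $x$ attaining $\mathsf{OPT}$. *)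

theory Defs
  imports "HOL-Probability.Probability"
begin

text \<open>Vectors in R^k are functions nat => real (only indices below k matter);
  an n x d matrix is a function nat => nat => real (entries A i j, i < n, j < d).\<close>

definition lip1 :: "(real \<Rightarrow> real) \<Rightarrow> bool" where
  "lip1 f \<longleftrightarrow> f 0 = 0 \<and> (\<forall>x y. \<bar>f x - f y\<bar> \<le> \<bar>x - y\<bar>)"

definition matvec :: "nat \<Rightarrow> (nat \<Rightarrow> nat \<Rightarrow> real) \<Rightarrow> (nat \<Rightarrow> real) \<Rightarrow> nat \<Rightarrow> real" where
  "matvec d A x i = (\<Sum>j<d. A i j * x j)"

definition normpp :: "nat \<Rightarrow> real \<Rightarrow> (nat \<Rightarrow> real) \<Rightarrow> real" where
  "normpp n p v = (\<Sum>i<n. \<bar>v i\<bar> powr p)"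

definition loss :: "nat \<Rightarrow> nat \<Rightarrow> real \<Rightarrow> (nat \<Rightarrow> nat \<Rightarrow> real) \<Rightarrow> (real \<Rightarrow> real) \<Rightarrow> (nat \<Rightarrow> real) \<Rightarrow> (nat \<Rightarrow> real) \<Rightarrow> real" where
  "loss n d p A f b x = normpp n p (\<lambda>i. f (matvec d A x i) - b i)"

definition OPT :: "nat \<Rightarrow> nat \<Rightarrow> real \<Rightarrow> (nat \<Rightarrow> nat \<Rightarrow> real) \<Rightarrow> (real \<Rightarrow> real) \<Rightarrow> (nat \<Rightarrow> real) \<Rightarrow> real" where
  "OPT n d p A f b = (INF x. loss n d p A f b x)"

definition is_xstar :: "nat \<Rightarrow> nat \<Rightarrow> real \<Rightarrow> (nat \<Rightarrow> nat \<Rightarrow> real) \<Rightarrow> (real \<Rightarrow> real) \<Rightarrow> (nat \<Rightarrow> real) \<Rightarrow> (nat \<Rightarrow> real) \<Rightarrow> bool" where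
  "is_xstar n d p A f b xs \<longleftrightarrow>
     loss n d p A f b xs = OPT n d p A f b \<and>
     (\<forall>x. loss n d p A f b x = OPT n d p A f b \<longrightarrow> normpp n p (matvec d A xs) \<le> normpp n p (matvec d A x))"

definition guarantee :: "nat \<Rightarrow> nat \<Rightarrow> real \<Rightarrow> real \<Rightarrow> (nat \<Rightarrow> nat \<Rightarrow> real) \<Rightarrow> (real \<Rightarrow> real) \<Rightarrow> (nat \<Rightarrow> real) \<Rightarrow> (nat \<Rightarrow> real) \<Rightarrow> bool" where
  "guarantee n d p \<epsilon> A f b xhat \<longleftrightarrow>
     (\<forall>xs. is_xstar n d p A f b xs \<longrightarrow>
        loss n d p A f b xhat \<le> OPT n d p A f b + \<epsilon> * (OPT n d p A f b + normpp n p (matvec d A xs)))"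

definition valid_input :: "nat \<Rightarrow> nat \<Rightarrow> (nat \<Rightarrow> nat \<Rightarrow> real) \<Rightarrow> (nat \<Rightarrow> real) \<Rightarrow> bool" where
  "valid_input n d A b \<longleftrightarrow> (\<forall>i j. (n \<le> i \<or> d \<le> j) \<longrightarrow> A i j = 0) \<and> (\<forall>i. n \<le> i \<longrightarrow> b i = 0)"

text \<open>A deterministic adaptive query strategy: given the answers received so far,
  either query entry i of b (Inl i) or stop and output a vector (Inr x).
  run S b k h executes S with at most k further queries starting from history h;
  it returns (number of queries made, output), or None if k queries do not suffice.\<close>
type_synonym strategy = "real list \<Rightarrow> nat + (nat \<Rightarrow> real)"

fun run :: "strategy \<Rightarrow> (nat \<Rightarrow> real) \<Rightarrow> nat \<Rightarrow> real list \<Rightarrow> (nat \<times> (nat \<Rightarrow> real)) option" where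
  "run S b 0 h = (case S h of Inl i \<Rightarrow> None | Inr x \<Rightarrow> Some (0, x))"
| "run S b (Suc k) h = (case S h of
      Inl i \<Rightarrow> map_option (\<lambda>(q, x). (Suc q, x)) (run S b k (h @ [b i]))
    | Inr x \<Rightarrow> Some (0, x))"

text \<open>A randomized algorithm: a probability space M of random seeds and, for each seed,
  a deterministic strategy depending on A and f. It makes at most q queries to b on every input
  and every seed, and satisfies the guarantee with probability at least 4/5 on every input.\<close>
definition good_alg :: "nat \<Rightarrow> nat \<Rightarrow> real \<Rightarrow> real \<Rightarrow> (nat \<Rightarrow> real) measure \<Rightarrow>
    ((nat \<Rightarrow> real) \<Rightarrow> (nat \<Rightarrow> nat \<Rightarrow> real) \<Rightarrow> (real \<Rightarrow> real) \<Rightarrow> strategy) \<Rightarrow> nat \<Rightarrow> bool" where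
  "good_alg n d p \<epsilon> M alg q \<longleftrightarrow>
     prob_space M \<and>
     (\<forall>A b f. valid_input n d A b \<and> lip1 f \<longrightarrow>
        (\<forall>\<omega>\<in>space M. run (alg \<omega> A f) b q [] \<noteq> None) \<and>
        {\<omega> \<in> space M. guarantee n d p \<epsilon> A f b (snd (the (run (alg \<omega> A f) b q [])))} \<in> sets M \<and>
        measure M {\<omega> \<in> space M. guarantee n d p \<epsilon> A f b (snd (the (run (alg \<omega> A f) b q [])))} \<ge> 4/5)"

end

theory Submission
  imports Defs
begin

text \<open>
  Each coordinate of x gets its own block of 2h rows, the first h with entry 1, the others with
  entry -1. The activation f satisfies f(1) = 1 and f(-1) = 1/2, and b is 1 on the block except for
  a spike of height s at one hidden row, where s is of order 1/\<epsilon> and h of order s^p. The two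
  orientations x_k = 1 and x_k = -1 fit the unspiked rows equally well, so the optimal one is
  decided by the half in which the spike lies; choosing the other one costs about s^(p-1), a large
  constant times \<epsilon> times the contribution of the block to OPT + |Ax*|^p. Hence an accurate output
  has the correct sign in at least nine tenths of the blocks, while an algorithm that has not seen
  the spike of a block can only guess the sign there.
\<close>

section \<open>Queried positions\<close>

fun queried :: "strategy \<Rightarrow> (nat \<Rightarrow> real) \<Rightarrow> nat \<Rightarrow> real list \<Rightarrow> nat set" where
  "queried S b 0 hs = {}"
| "queried S b (Suc k) hs = (case S hs of
      Inl i \<Rightarrow> insert i (queried S b k (hs @ [b i]))
    | Inr x \<Rightarrow> {})"

lemma finite_queried: "finite (queried S b k hs)"
  by (induction k arbitrary: hs) (auto split: sum.split)

lemma card_queried_le: "card (queried S b k hs) \<le> k"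
proof (induction k arbitrary: hs)
  case (Suc k)
  show ?case
    using Suc[of "hs @ [b i]" for i]
    by (auto split: sum.split intro!: order_trans[OF card_insert_le_m1] simp: card_insert_if finite_queried le_SucI)
qed simp

lemma run_fun_upd:
  "i \<notin> queried S b k hs \<Longrightarrow> run S (b(i := v)) k hs = run S b k hs"
  by (induction k arbitrary: hs) (auto split: sum.splits)

text \<open>The run on b proceeds unchanged up to its first query to i or j, so that query is also made
  if b is altered at the other position.\<close>

lemma queried_fun_upd_cases:
  "i \<in> queried S b k hs \<Longrightarrow>
    i \<in> queried S (b(j := v)) k hs \<or> j \<in> queried S (b(i := w)) k hs"
  by (induction k arbitrary: hs) (auto split: sum.splits)

text \<open>For \<open>i\<close> in the queried set and \<open>j\<close> in \<open>B\<close>, either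
  the run altered at \<open>j\<close> queries \<open>i\<close> or the run altered at
  \<open>i\<close> queries \<open>j\<close>. Summing over pairs uses each such incidence at most
  twice. This moves a query count from the unspiked run, which differs from block to block, to the
  actual instances.\<close>

lemma sum_card_queried_ge:
  assumes "finite B"
  shows "card (queried S b q hs \<inter> B) * card B
    \<le> 2 * (\<Sum>j\<in>B. card (queried S (b(j := v)) q hs \<inter> B))"
proof -
  let ?R = "queried S b q hs \<inter> B"
  let ?Q = "\<lambda>j. queried S (b(j := v)) q hs"
  let ?c = "\<lambda>i j. if i \<in> ?Q j then 1 else (0::nat)"
  have c: "card (?Q j \<inter> B) = (\<Sum>i\<in>B. ?c i j)" for j
    using assms by (simp add: sum.If_cases Int_commute)
  have "card ?R * card B = (\<Sum>i\<in>?R. \<Sum>j\<in>B. 1)"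
    by simp
  also have "\<dots> \<le> (\<Sum>i\<in>?R. \<Sum>j\<in>B. ?c i j + ?c j i)"
    using queried_fun_upd_cases[of _ S b q hs _ v v] by (intro sum_mono) auto
  also have "\<dots> \<le> (\<Sum>i\<in>B. \<Sum>j\<in>B. ?c i j + ?c j i)"
    using assms by (intro sum_mono2) auto
  also have "\<dots> = (\<Sum>i\<in>B. \<Sum>j\<in>B. ?c i j) + (\<Sum>i\<in>B. \<Sum>j\<in>B. ?c j i)"
    by (simp only: sum.distrib)
  also have "(\<Sum>i\<in>B. \<Sum>j\<in>B. ?c i j) = (\<Sum>j\<in>B. \<Sum>i\<in>B. ?c i j)"
    by (rule sum.swap)
  finally show ?thesis
    by (simp only: c mult_2)
qed

text \<open>Resampling one coordinate of a uniformly random placement keeps it uniform: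
  \<open>(J, j)\<close> maps to \<open>(J(k := j), J k)\<close>, an involution.\<close>

lemma sum_PiE_fun_upd:
  assumes "k \<in> I"
  shows "(\<Sum>J\<in>I \<rightarrow>\<^sub>E T. \<Sum>j\<in>T. g (J(k := j))) = card T * (\<Sum>J\<in>I \<rightarrow>\<^sub>E T. g J :: nat)"
proof -
  have "(\<Sum>J\<in>I \<rightarrow>\<^sub>E T. \<Sum>j\<in>T. g (J(k := j))) = (\<Sum>(J, j)\<in>(I \<rightarrow>\<^sub>E T) \<times> T. g (J(k := j)))"
    by (rule sum.cartesian_product)
  also have "\<dots> = (\<Sum>(J, j)\<in>(I \<rightarrow>\<^sub>E T) \<times> T. g J)"
    using assms
    by (intro sum.reindex_bij_witness[where i = "\<lambda>(J, j). (J(k := j), J k)"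
          and j = "\<lambda>(J, j). (J(k := j), J k)"])
       (auto simp: PiE_def Pi_def extensional_def)
  also have "\<dots> = (\<Sum>J\<in>I \<rightarrow>\<^sub>E T. \<Sum>j\<in>T. g J)"
    by (rule sum.cartesian_product[symmetric])
  finally show ?thesis
    by (simp add: sum_distrib_left)
qed

text \<open>The expected number of events that contain the seed is at least
  \<open>c * card I\<close>, so some seed attains this. It replaces the randomized algorithm by one
  deterministic strategy that is accurate on many placements.\<close>

lemma (in prob_space) exists_in_many_events:
  assumes "finite I" and "\<And>i. i \<in> I \<Longrightarrow> E i \<in> events" and "\<And>i. i \<in> I \<Longrightarrow> prob (E i) \<ge> c"
  shows "\<exists>\<omega>\<in>space M. c * card I \<le> card {i \<in> I. \<omega> \<in> E i}"
proof (rule ccontr)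
  assume "\<not> ?thesis"
  then have less: "real (card {i \<in> I. \<omega> \<in> E i}) < c * card I" if "\<omega> \<in> space M" for \<omega>
    using that by force
  have sum_eq: "(\<Sum>i\<in>I. indicator (E i) \<omega>) = real (card {i \<in> I. \<omega> \<in> E i})" for \<omega>
    using assms(1) by (simp add: indicator_def sum.If_cases Int_def)
  have int: "integrable M (\<lambda>\<omega>. \<Sum>i\<in>I. indicator (E i) \<omega> :: real)"
    using assms(2) by (intro Bochner_Integration.integrable_sum integrable_real_indicator) (auto simp: emeasure_eq_measure)
  have "(\<Sum>i\<in>I. prob (E i)) = expectation (\<lambda>\<omega>. \<Sum>i\<in>I. indicator (E i) \<omega>)"
    using assms(2) by (subst Bochner_Integration.integral_sum)
      (auto simp: emeasure_eq_measure intro!: integrable_real_indicator)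
  also have "\<dots> < c * card I"
    using less sum_eq int by (intro expectation_less) auto
  finally show False
    using sum_mono[of I "\<lambda>_. c" "\<lambda>i. prob (E i)"] assms(3) by (simp add: mult.commute)
qed

section \<open>The hard instances\<close>

text \<open>A V shape at 0 with slopes -1/2 and 1, constant 1/2 left of -1 and constant 1 right of
  1.\<close>

definition act :: "real \<Rightarrow> real" where
  "act y = max (min y 1) (min (- y / 2) (1 / 2))"

lemma lip1_act: "lip1 act"
  unfolding lip1_def act_def by (auto simp: min_def max_def abs_if field_simps)

lemma act_le_1: "act y \<le> 1"
  by (simp add: act_def min_def max_def)

lemma act_le_half: "y \<le> 0 \<Longrightarrow> act y \<le> 1 / 2"
  by (simp add: act_def min_def max_def)

lemma act_less_1: "\<bar>y\<bar> < 1 \<Longrightarrow> act y < 1"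
  by (auto simp: act_def min_def max_def)

lemma act_1 [simp]: "act 1 = 1" and act_minus_1 [simp]: "act (-1) = 1 / 2"
  by (simp_all add: act_def)

locale hard_instance =
  fixes n d h :: nat and p s :: real
  assumes h_pos: "h > 0" and p_ge: "p \<ge> 2" and s_ge: "s \<ge> 3" and n_ge: "d * (2 * h) \<le> n"
begin

definition side :: "nat \<Rightarrow> real" where
  "side r = (if r < h then 1 else -1)"

definition A :: "nat \<Rightarrow> nat \<Rightarrow> real" where
  "A i j = (if i < d * (2 * h) \<and> j = i div (2 * h) then side (i mod (2 * h)) else 0)"

text \<open>The spike of block k is at its row J k; a value outside the block means no spike.\<close>

definition b :: "(nat \<Rightarrow> nat) \<Rightarrow> nat \<Rightarrow> real" where
  "b J i = (if i < d * (2 * h) then (if i mod (2 * h) = J (i div (2 * h)) then s else 1) else 0)"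

definition block_loss :: "real \<Rightarrow> nat \<Rightarrow> real" where
  "block_loss y j = (\<Sum>r<2*h. \<bar>act (side r * y) - (if r = j then s else 1)\<bar> powr p)"

text \<open>The loss of a block oriented towards its spike: h rows have activation 1/2 against
  target 1, the spike has 1 against s, and the others fit exactly.\<close>

definition opt_block :: real where
  "opt_block = h * (1 / 2) powr p + (s - 1) powr p"

text \<open>The extra cost of the wrong orientation. The spike now meets activation 1/2 instead of
  1; since it occupies a row of the half at 1/2, one ordinary cost (1/2)^p is saved.\<close>

definition gap :: real where
  "gap = (s - 1 / 2) powr p - (s - 1) powr p - (1 / 2) powr p"

lemma side_cases: "side r = 1 \<or> side r = -1"
  by (simp add: side_def)

lemma card_side: "card {r. r < 2 * h \<and> side r = 1} = h" "card {r. r < 2 * h \<and> side r = -1} = h"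
proof -
  have "{r. r < 2 * h \<and> side r = 1} = {..<h}" "{r. r < 2 * h \<and> side r = -1} = {h..<2*h}"
    by (auto simp: side_def)
  then show "card {r. r < 2 * h \<and> side r = 1} = h" "card {r. r < 2 * h \<and> side r = -1} = h"
    by simp_all
qed

section \<open>Block structure of the product and of the loss\<close>

lemma valid: "valid_input n d A (b J)"
  using n_ge less_mult_imp_div_less[of _ d "2 * h"]
  by (fastforce simp: valid_input_def A_def b_def)

lemma row_less: "k < d \<Longrightarrow> r < 2 * h \<Longrightarrow> k * (2 * h) + r < d * (2 * h)"
proof -
  assume "k < d" "r < 2 * h"
  then have "k * (2 * h) + r < Suc k * (2 * h)" "Suc k * (2 * h) \<le> d * (2 * h)"
    by (auto simp del: mult_Suc intro!: mult_le_mono1) simp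
  then show ?thesis by linarith
qed

lemma matvec_A:
  "matvec d A x i = (if i < d * (2 * h) then side (i mod (2 * h)) * x (i div (2 * h)) else 0)"
proof (cases "i < d * (2 * h)")
  case True
  then have "i div (2 * h) < d"
    by (simp add: less_mult_imp_div_less)
  have "matvec d A x i = (\<Sum>j<d. if j = i div (2 * h) then side (i mod (2 * h)) * x j else 0)"
    unfolding matvec_def A_def using True by (intro sum.cong) auto
  with \<open>i div (2 * h) < d\<close> True show ?thesis by simp
qed (simp add: matvec_def A_def)

lemma sum_rows:
  fixes g :: "nat \<Rightarrow> real"
  assumes "\<And>i. i \<ge> d * (2 * h) \<Longrightarrow> g i = 0"
  shows "(\<Sum>i<n. g i) = (\<Sum>k<d. \<Sum>r<2*h. g (k * (2 * h) + r))"
proof -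
  have "(\<Sum>i<n. g i) = (\<Sum>i<d*(2*h). g i)"
    using assms n_ge by (intro sum.mono_neutral_right) auto
  also have "\<dots> = (\<Sum>k<d. \<Sum>i=k*(2*h)..<k*(2*h)+2*h. g i)"
    by (rule sum.nat_group[symmetric])
  also have "\<dots> = (\<Sum>k<d. \<Sum>r<2*h. g (k * (2 * h) + r))"
  proof (rule sum.cong[OF refl])
    fix k
    show "(\<Sum>i=k*(2*h)..<k*(2*h)+2*h. g i) = (\<Sum>r<2*h. g (k * (2 * h) + r))"
      using sum.shift_bounds_nat_ivl[of g 0 "k * (2 * h)" "2 * h"]
      by (simp add: atLeast0LessThan add.commute)
  qed
  finally show ?thesis .
qed

lemma loss_eq: "loss n d p A act (b J) x = (\<Sum>k<d. block_loss (x k) (J k))"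
proof -
  \<comment> \<open>Rows beyond the blocks have product 0 and target 0, so they cost
    nothing.\<close>
  have act_0: "act 0 = 0" by (simp add: act_def)
  have "loss n d p A act (b J) x = (\<Sum>k<d. \<Sum>r<2*h.
      \<bar>act (matvec d A x (k * (2 * h) + r)) - b J (k * (2 * h) + r)\<bar> powr p)"
    unfolding loss_def normpp_def by (rule sum_rows) (simp add: matvec_A b_def act_0)
  also have "\<dots> = (\<Sum>k<d. block_loss (x k) (J k))"
    unfolding block_loss_def using row_less h_pos
    by (intro sum.cong refl) (simp add: matvec_A b_def div_mult_self3)
  finally show ?thesis .
qed

section \<open>Lower bounds for the loss of one block\<close>

lemma powr_dist_ge: "a \<le> u \<Longrightarrow> u \<le> v \<Longrightarrow> (v - u) powr p \<le> \<bar>a - v\<bar> powr p"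
  using p_ge by (intro powr_mono2) auto

lemma block_loss_split:
  assumes "j < 2 * h"
  shows "block_loss y j = \<bar>act (side j * y) - s\<bar> powr p
    + (\<Sum>r\<in>{..<2*h}-{j}. \<bar>act (side r * y) - 1\<bar> powr p)"
  unfolding block_loss_def using assms by (subst sum.remove[of _ j]) auto

lemma sum_half_rows_ge:
  assumes "P \<subseteq> {..<2*h} - {j}" and "\<And>r. r \<in> P \<Longrightarrow> side r * y \<le> 0"
  shows "card P * (1 / 2) powr p \<le> (\<Sum>r\<in>{..<2*h}-{j}. \<bar>act (side r * y) - 1\<bar> powr p)"
proof -
  have "(1 / 2) powr p \<le> \<bar>act (side r * y) - 1\<bar> powr p" if "r \<in> P" for r
    using powr_dist_ge[OF act_le_half[OF assms(2)[OF that]], of 1] by simp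
  then have "card P * (1 / 2) powr p \<le> (\<Sum>r\<in>P. \<bar>act (side r * y) - 1\<bar> powr p)"
    using sum_mono[of P "\<lambda>_. (1 / 2) powr p"] by simp
  also have "\<dots> \<le> (\<Sum>r\<in>{..<2*h}-{j}. \<bar>act (side r * y) - 1\<bar> powr p)"
    using assms(1) by (intro sum_mono2) auto
  finally show ?thesis .
qed

text \<open>The h rows of the half without the spike have argument <= 0, hence cost at least (1/2)^p
  each. The spike term is kept exact for the sake of \<open>opt_block_less\<close>.\<close>

lemma block_loss_right:
  assumes "j < 2 * h" "side j * y \<ge> 0"
  shows "block_loss y j \<ge> h * (1 / 2) powr p + \<bar>act (side j * y) - s\<bar> powr p"
proof -
  let ?P = "{r. r < 2 * h \<and> side r = - side j}"
  have "card ?P = h"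
    using side_cases[of j] card_side by auto
  moreover have "?P \<subseteq> {..<2*h} - {j}"
    using side_cases[of j] by auto
  ultimately show ?thesis
    using sum_half_rows_ge[of ?P j y] assms block_loss_split[of j y] by auto
qed

text \<open>Here the half containing the spike has arguments <= 0. It offers only h - 1 ordinary
  rows, and the spike costs at least (s - 1/2)^p.\<close>

lemma block_loss_wrong:
  assumes "j < 2 * h" "side j * y \<le> 0"
  shows "block_loss y j \<ge> opt_block + gap"
proof -
  let ?P = "{r. r < 2 * h \<and> side r = side j} - {j}"
  have "card ?P = h - 1"
    using side_cases[of j] card_side assms(1) by (subst card_Diff_singleton) auto
  then have "(real h - 1) * (1 / 2) powr p \<le> (\<Sum>r\<in>{..<2*h}-{j}. \<bar>act (side r * y) - 1\<bar> powr p)"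
    using sum_half_rows_ge[of ?P j y] assms h_pos by (auto simp: of_nat_diff)
  moreover have "(s - 1 / 2) powr p \<le> \<bar>act (side j * y) - s\<bar> powr p"
    using s_ge by (intro powr_dist_ge act_le_half assms) auto
  ultimately show ?thesis
    using block_loss_split[OF assms(1), of y] by (simp add: opt_block_def gap_def algebra_simps)
qed

text \<open>Splitting one factor s - 1/2 off the first power bounds \<open>gap\<close> below by (s -
  1)^(p-1) / 2 - (1/2)^p. Since (s - 1)^(p-1) >= (s/2)^(p-1) + (1/2)^(p-1), the last summand absorbs
  the subtracted term.\<close>

lemma gap_ge: "gap \<ge> (1 / 2) powr p * s powr (p - 1)"
proof -
  have eq: "x powr q = x * x powr (q - 1)" if "x > 0" for x q :: real
    using that powr_add[of x 1 "q - 1"] by simp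
  have "(s - 1) powr p + (s - 1) powr (p - 1) / 2 = (s - 1 / 2) * (s - 1) powr (p - 1)"
    using s_ge by (subst eq[of "s - 1" p]) (auto simp: algebra_simps)
  also have "\<dots> \<le> (s - 1 / 2) * (s - 1 / 2) powr (p - 1)"
    using s_ge p_ge by (intro mult_left_mono powr_mono2) auto
  also have "\<dots> = (s - 1 / 2) powr p"
    using s_ge by (intro eq[symmetric]) auto
  finally have 1: "(s - 1) powr p + (s - 1) powr (p - 1) / 2 \<le> (s - 1 / 2) powr p" .
  \<comment> \<open>Again one factor is split off. The exponent p - 2 is nonnegative, and s >= 3 is
    exactly what s/2 + 1/2 <= s - 1 requires.\<close>
  have "(s / 2) powr (p - 1) + (1 / 2) powr (p - 1)
      = s / 2 * (s / 2) powr (p - 1 - 1) + 1 / 2 * (1 / 2) powr (p - 1 - 1)"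
    using s_ge by (intro arg_cong2[of _ _ _ _ "(+)"] eq) auto
  also have "\<dots> \<le> s / 2 * (s - 1) powr (p - 1 - 1) + 1 / 2 * (s - 1) powr (p - 1 - 1)"
    using s_ge p_ge by (intro add_mono mult_left_mono powr_mono2) auto
  also have "\<dots> = (s / 2 + 1 / 2) * (s - 1) powr (p - 1 - 1)"
    by (simp add: algebra_simps)
  also have "\<dots> \<le> (s - 1) * (s - 1) powr (p - 1 - 1)"
    using s_ge by (intro mult_right_mono) auto
  also have "\<dots> = (s - 1) powr (p - 1)"
    using s_ge by (intro eq[symmetric]) auto
  finally have 2: "(s / 2) powr (p - 1) + (1 / 2) powr (p - 1) \<le> (s - 1) powr (p - 1)" .
  have 3: "(1 / 2) powr p = (1 / 2) powr (p - 1) / (2 :: real)"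
    using eq[of "1 / 2" p] by simp
  have 4: "(s / 2) powr (p - 1) = (1 / 2) powr (p - 1) * s powr (p - 1)"
    using s_ge powr_mult[of "1 / 2" s "p - 1"] by simp
  show ?thesis
    using 1 2 unfolding gap_def 3 4 by (simp add: algebra_simps)
qed

lemma gap_pos: "gap > 0"
proof -
  have "0 < (1 / 2) powr p * s powr (p - 1)"
    using s_ge by simp
  with gap_ge show ?thesis by linarith
qed

lemma opt_block_le: "j < 2 * h \<Longrightarrow> opt_block \<le> block_loss y j"
proof (cases "side j * y \<ge> 0")
  case True
  assume "j < 2 * h"
  with True show ?thesis
    using block_loss_right[of j y] powr_dist_ge[OF act_le_1, of s "side j * y"] s_ge
    by (simp add: opt_block_def)
qed (use block_loss_wrong[of j y] gap_pos in auto)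

text \<open>Inside (-1, 1) the activation stays below 1, so even with the right sign the spike costs
  more than (s - 1)^p. This forces |x k| >= 1 at every minimizer.\<close>

lemma opt_block_less:
  assumes "j < 2 * h" "\<bar>y\<bar> < 1"
  shows "opt_block < block_loss y j"
proof (cases "side j * y \<ge> 0")
  case True
  have "act (side j * y) < 1"
    using assms(2) side_cases[of j] by (intro act_less_1) auto
  then have "(s - 1) powr p < \<bar>act (side j * y) - s\<bar> powr p"
    using s_ge p_ge by (intro powr_less_mono2) auto
  with True assms show ?thesis
    using block_loss_right[of j y] by (simp add: opt_block_def)
qed (use block_loss_wrong[of j y] gap_pos assms in auto)

lemma block_loss_opt:
  assumes "j < 2 * h"
  shows "block_loss (side j) j = opt_block"
proof -
  let ?P = "{r. r < 2 * h \<and> side r = - side j}"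
  have "card ?P = h"
    using side_cases[of j] card_side by auto
  have "(\<Sum>r\<in>{..<2*h}-{j}. \<bar>act (side r * side j) - 1\<bar> powr p)
      = (\<Sum>r\<in>{..<2*h}-{j}. if side r = - side j then (1 / 2) powr p else 0)"
  proof (intro sum.cong refl)
    fix r
    show "\<bar>act (side r * side j) - 1\<bar> powr p = (if side r = - side j then (1 / 2) powr p else 0)"
      using side_cases[of r] side_cases[of j] by auto
  qed
  also have "\<dots> = (\<Sum>r\<in>?P. (1 / 2) powr p)"
    using side_cases[of j] by (intro sum.mono_neutral_cong_right) auto
  finally have "(\<Sum>r\<in>{..<2*h}-{j}. \<bar>act (side r * side j) - 1\<bar> powr p) = h * (1 / 2) powr p"
    using \<open>card ?P = h\<close> by simp
  moreover have "side j * side j = 1"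
    using side_cases[of j] by auto
  ultimately show ?thesis
    using s_ge by (simp add: block_loss_split[OF assms] opt_block_def)
qed

section \<open>Optimum, minimizer of least norm, and wrong signs\<close>

definition positions :: "(nat \<Rightarrow> nat) set" where
  "positions = {..<d} \<rightarrow>\<^sub>E {..<2*h}"

lemma positions_less: "J \<in> positions \<Longrightarrow> k < d \<Longrightarrow> J k < 2 * h"
  by (auto simp: positions_def)

lemma finite_positions: "finite positions"
  by (simp add: positions_def finite_PiE)

lemma positions_nonempty: "positions \<noteq> {}"
proof -
  have "(\<lambda>k\<in>{..<d}. 0) \<in> positions"
    using h_pos by (simp add: positions_def)
  then show ?thesis by blast
qed

lemma OPT_eq:
  assumes "J \<in> positions"
  shows "OPT n d p A act (b J) = d * opt_block"
proof -
  have "loss n d p A act (b J) (\<lambda>k. side (J k)) = d * opt_block"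
    using assms by (simp add: loss_eq block_loss_opt positions_less)
  moreover have "d * opt_block \<le> loss n d p A act (b J) x" for x
    using sum_mono[of "{..<d}" "\<lambda>_. opt_block" "\<lambda>k. block_loss (x k) (J k)"] assms
    by (simp add: loss_eq opt_block_le positions_less)
  ultimately show ?thesis
    unfolding OPT_def by (intro cInf_eq_minimum) (auto intro: rangeI dest: sym)
qed

text \<open>Equality of the sums makes every block optimal, so each minimizer has |x k| >= 1 and its
  product dominates that of the sign vector entrywise. A concrete minimizer of least norm is what
  makes \<open>guarantee\<close> applicable.\<close>

lemma is_xstar_side:
  assumes "J \<in> positions"
  shows "is_xstar n d p A act (b J) (\<lambda>k. side (J k))"
  unfolding is_xstar_def
proof (intro conjI allI impI)
  show "loss n d p A act (b J) (\<lambda>k. side (J k)) = OPT n d p A act (b J)"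
    using assms by (simp add: loss_eq OPT_eq block_loss_opt positions_less)
next
  fix x assume "loss n d p A act (b J) x = OPT n d p A act (b J)"
  then have eq: "(\<Sum>k<d. block_loss (x k) (J k)) = (\<Sum>k<d. opt_block)"
    using assms by (simp add: loss_eq OPT_eq)
  have x_ge: "\<bar>x k\<bar> \<ge> 1" if "k < d" for k
  proof (rule ccontr)
    assume "\<not> \<bar>x k\<bar> \<ge> 1"
    then have "(\<Sum>k<d. opt_block) < (\<Sum>k<d. block_loss (x k) (J k))"
      using assms that opt_block_less[of "J k" "x k"]
      by (intro sum_strict_mono2[of _ _ k] sum_strict_mono_ex1) (auto intro: opt_block_le positions_less)
    with eq show False by simp
  qed
  show "normpp n p (matvec d A (\<lambda>k. side (J k))) \<le> normpp n p (matvec d A x)"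
    unfolding normpp_def
  proof (intro sum_mono powr_mono2)
    fix i
    show "\<bar>matvec d A (\<lambda>k. side (J k)) i\<bar> \<le> \<bar>matvec d A x i\<bar>"
      using x_ge[of "i div (2 * h)"] by (auto simp: matvec_A side_def abs_mult less_mult_imp_div_less)
  qed (use p_ge in auto)
qed

lemma normpp_side: "normpp n p (matvec d A (\<lambda>k. side (J k))) = d * (2 * h)"
proof -
  have "normpp n p (matvec d A (\<lambda>k. side (J k)))
      = (\<Sum>k<d. \<Sum>r<2*h. \<bar>matvec d A (\<lambda>k. side (J k)) (k * (2 * h) + r)\<bar> powr p)"
    unfolding normpp_def by (rule sum_rows) (simp add: matvec_A)
  also have "\<dots> = (\<Sum>k<d. \<Sum>r<2*h. 1)"
    using row_less by (intro sum.cong refl) (auto simp: matvec_A abs_mult side_def)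
  finally show ?thesis by simp
qed

text \<open>A zero coordinate counts as wrong for either half, so every output is wrong for at least
  one half of each block.\<close>

definition wrong :: "(nat \<Rightarrow> nat) \<Rightarrow> (nat \<Rightarrow> real) \<Rightarrow> nat set" where
  "wrong J x = {k. k < d \<and> side (J k) * x k \<le> 0}"

lemma card_wrong_le: "card (wrong J x) \<le> d"
  using card_mono[of "{..<d}" "wrong J x"] by (auto simp: wrong_def)

text \<open>Each wrong block exceeds \<open>opt_block\<close> by at least \<open>gap\<close>, while
  the guarantee at the sign vector caps the total excess; every block contributes 2h to the norm
  term.\<close>

lemma guarantee_imp_few_wrong:
  assumes "J \<in> positions" and "guarantee n d p \<epsilon> A act (b J) x"
  shows "card (wrong J x) * gap \<le> \<epsilon> * (d * (opt_block + 2 * h))"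
proof -
  have "(\<Sum>k<d. opt_block + (if k \<in> wrong J x then gap else 0)) \<le> (\<Sum>k<d. block_loss (x k) (J k))"
    using assms(1) by (intro sum_mono) (auto simp: wrong_def intro: opt_block_le block_loss_wrong positions_less)
  moreover have "(\<Sum>k<d. if k \<in> wrong J x then gap else 0) = card (wrong J x) * gap"
  proof -
    have "{..<d} \<inter> wrong J x = wrong J x"
      by (auto simp: wrong_def)
    then show ?thesis by (simp add: sum.If_cases)
  qed
  ultimately have "d * opt_block + card (wrong J x) * gap \<le> loss n d p A act (b J) x"
    by (simp add: sum.distrib loss_eq)
  also have "\<dots> \<le> OPT n d p A act (b J)
      + \<epsilon> * (OPT n d p A act (b J) + normpp n p (matvec d A (\<lambda>k. side (J k))))"
    using assms is_xstar_side unfolding guarantee_def by blast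
  finally show ?thesis
    using assms(1) by (simp add: OPT_eq normpp_side algebra_simps)
qed

section \<open>Counting wrong signs\<close>

text \<open>A failed run yields the fixed vector \<open>snd (the None)\<close>, so the counting
  below applies to any strategy.\<close>

definition answer :: "strategy \<Rightarrow> nat \<Rightarrow> (nat \<Rightarrow> nat) \<Rightarrow> nat \<Rightarrow> real" where
  "answer S q J = snd (the (run S (b J) q []))"

definition block :: "nat \<Rightarrow> nat set" where
  "block k = (\<lambda>r. k * (2 * h) + r) ` {..<2*h}"

text \<open>The value \<open>2 * h\<close> is no residue and hence removes the spike. All placements
  in block k thus become one-entry updates of a common input.\<close>

lemma b_fun_upd:
  assumes "k < d" "j < 2 * h"
  shows "b (J(k := j)) = (b (J(k := 2 * h)))(k * (2 * h) + j := s)"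
proof
  fix i
  have "i = k * (2 * h) + j \<longleftrightarrow> i div (2 * h) = k \<and> i mod (2 * h) = j"
    using assms(2) div_mult_mod_eq[of i "2 * h"] by (auto simp del: div_mult_mod_eq)
  moreover have "i mod (2 * h) \<noteq> 2 * h"
    using h_pos by (metis less_irrefl mod_less_divisor mult_pos_pos zero_less_numeral)
  ultimately show "b (J(k := j)) i = ((b (J(k := 2 * h)))(k * (2 * h) + j := s)) i"
    using row_less[OF assms] by (auto simp: b_def)
qed

text \<open>All placements of the spike in block k are compared with the run on the input without spike
  in block k, which produces the same output unless it queries the spike.\<close>

lemma block_count:
  assumes k: "k < d"
  shows "h * h \<le> (\<Sum>j<2*h. h * of_bool (k \<in> wrong (J(k := j)) (answer S q (J(k := j))))
    + card (queried S (b (J(k := j))) q [] \<inter> block k))"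
proof -
  define b0 where "b0 = b (J(k := 2 * h))"
  define x where "x = snd (the (run S b0 q []))"
  define R where "R = queried S b0 q [] \<inter> block k"
  define pos where "pos = (\<lambda>r. k * (2 * h) + r)"
  \<comment> \<open>The half for which the output \<open>x\<close> of the unspiked run has the wrong
    sign.\<close>
  define \<tau> :: real where "\<tau> = (if x k \<le> 0 then 1 else -1)"
  define P where "P = {j. j < 2 * h \<and> side j = \<tau>}"
  let ?w = "\<lambda>j. of_bool (k \<in> wrong (J(k := j)) (answer S q (J(k := j)))) :: nat"
  have inj: "inj_on pos X" for X
    by (simp add: pos_def inj_on_def)
  have block: "block k = pos ` {..<2*h}"
    by (simp add: block_def pos_def)
  have fin: "finite R" "finite (block k)"
    by (auto simp: R_def block_def)
  have upd: "b (J(k := j)) = b0(pos j := s)" if "j < 2 * h" for j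
    using b_fun_upd[OF k that] by (simp add: b0_def pos_def)
  have "card P = h"
    using card_side by (simp add: P_def \<tau>_def)
  have "?w j = 1" if "j \<in> P" "pos j \<notin> R" for j
  proof -
    have "pos j \<notin> queried S b0 q []"
      using that by (auto simp: R_def P_def block)
    then have "answer S q (J(k := j)) = x"
      using that by (simp add: answer_def upd P_def run_fun_upd x_def)
    then show ?thesis
      using that k by (auto simp: wrong_def P_def \<tau>_def)
  qed
  then have "card {j \<in> P. pos j \<notin> R} \<le> (\<Sum>j\<in>{j \<in> P. pos j \<notin> R}. ?w j)"
    by simp
  also have "\<dots> \<le> (\<Sum>j<2*h. ?w j)"
    by (intro sum_mono2) (auto simp: P_def)
  finally have 1: "card {j \<in> P. pos j \<notin> R} \<le> (\<Sum>j<2*h. ?w j)" .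
  \<comment> \<open>Of the h spike positions for which \<open>x\<close> is wrong, at most
    \<open>card R\<close> are seen by the unspiked run; at each of the others the same wrong answer
    is returned.\<close>
  have "card P = card {j \<in> P. pos j \<notin> R} + card {j \<in> P. pos j \<in> R}"
    by (subst card_Un_disjoint[symmetric]) (auto simp: P_def intro!: arg_cong[of _ _ card])
  moreover have "card {j \<in> P. pos j \<in> R} \<le> card R"
    using fin by (intro card_inj_on_le[of pos] inj) auto
  ultimately have 2: "h \<le> (\<Sum>j<2*h. ?w j) + card R"
    using 1 \<open>card P = h\<close> by linarith
  have "card (block k) = 2 * h"
    by (simp add: block card_image inj)
  \<comment> \<open>\<open>card R\<close> is paid for by queries on the spiked inputs. As the block
    has 2h rows, this costs a factor h, which is why the claim is scaled by h.\<close>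
  then have "card R * (2 * h) \<le> 2 * (\<Sum>i\<in>block k. card (queried S (b0(i := s)) q [] \<inter> block k))"
    using sum_card_queried_ge[OF fin(2), of S b0 q "[]" s] by (simp add: R_def)
  also have "(\<Sum>i\<in>block k. card (queried S (b0(i := s)) q [] \<inter> block k))
      = (\<Sum>j<2*h. card (queried S (b (J(k := j))) q [] \<inter> block k))"
    by (simp add: block sum.reindex[OF inj] upd)
  finally have "h * card R \<le> (\<Sum>j<2*h. card (queried S (b (J(k := j))) q [] \<inter> block k))"
    by (simp add: mult.commute)
  moreover have "h * h \<le> h * (\<Sum>j<2*h. ?w j) + h * card R"
    using mult_le_mono2[OF 2, of h] by (simp add: distrib_left)
  ultimately show ?thesis
    unfolding sum.distrib sum_distrib_left[symmetric] by linarith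
qed

lemma sum_block_queries_le: "(\<Sum>k<d. card (queried S c q [] \<inter> block k)) \<le> q"
proof -
  have "block k \<inter> block l = {}" if "k \<noteq> l" for k l
  proof -
    have "i div (2 * h) = k" if "i \<in> block k" for i k
      using that by (auto simp: block_def)
    with that show ?thesis by blast
  qed
  then have "(\<Sum>k<d. card (queried S c q [] \<inter> block k)) = card (\<Union>k<d. queried S c q [] \<inter> block k)"
    by (intro card_UN_disjoint[symmetric]) (auto simp: finite_queried)
  also have "\<dots> \<le> card (queried S c q [])"
    by (intro card_mono finite_queried) auto
  finally show ?thesis
    using card_queried_le order_trans by blast
qed

text \<open>Averaging \<open>block_count\<close> over the other blocks and summing over k: without
  queries about half of the signs are wrong, and per placement the queries of all blocks add up to
  at most q.\<close>

lemma sum_wrong_ge: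
  "d * h * card positions \<le> 2 * (\<Sum>J\<in>positions. h * card (wrong J (answer S q J)) + q)"
proof -
  let ?g = "\<lambda>k J. h * of_bool (k \<in> wrong J (answer S q J)) + card (queried S (b J) q [] \<inter> block k)"
  have "h * card positions \<le> 2 * (\<Sum>J\<in>positions. ?g k J)" if "k < d" for k
  proof -
    have "(\<Sum>J\<in>positions. h * h) \<le> (\<Sum>J\<in>positions. \<Sum>j<2*h. ?g k (J(k := j)))"
      by (intro sum_mono block_count that)
    \<comment> \<open>Resampling block k reaches each placement 2h times; one factor h then
      cancels.\<close>
    also have "\<dots> = card {..<2*h} * (\<Sum>J\<in>positions. ?g k J)"
      using that sum_PiE_fun_upd[of k "{..<d}" "?g k" "{..<2*h}"] by (simp add: positions_def)
    finally have "h * (h * card positions) \<le> h * (2 * (\<Sum>J\<in>positions. ?g k J))"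
      by (simp only: sum_constant card_lessThan mult_ac of_nat_id)
    then show ?thesis
      using h_pos by (simp only: mult_le_cancel1)
  qed
  then have "(\<Sum>k<d. h * card positions) \<le> (\<Sum>k<d. 2 * (\<Sum>J\<in>positions. ?g k J))"
    by (intro sum_mono) auto
  also have "\<dots> = 2 * (\<Sum>J\<in>positions. \<Sum>k<d. ?g k J)"
    by (subst sum.swap) (simp add: sum_distrib_left)
  also have "\<dots> \<le> 2 * (\<Sum>J\<in>positions. h * card (wrong J (answer S q J)) + q)"
  proof (intro mult_le_mono2 sum_mono)
    fix J
    have "(\<Sum>k<d. of_bool (k \<in> wrong J (answer S q J)) :: nat) = card (wrong J (answer S q J))"
    proof -
      have "{..<d} \<inter> wrong J (answer S q J) = wrong J (answer S q J)"
        by (auto simp: wrong_def)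
      then show ?thesis by simp
    qed
    then show "(\<Sum>k<d. ?g k J) \<le> h * card (wrong J (answer S q J)) + q"
      using sum_block_queries_le[of S "b J" q] by (simp add: sum.distrib flip: sum_distrib_left)
  qed
  finally show ?thesis by (simp add: mult.assoc)
qed

text \<open>A fixed seed is accurate on 4/5 of the placements, with at most d/10 wrong signs there
  and at most d elsewhere, so on average at most 3d/10. Comparison with the average hd/2 of
  \<open>sum_wrong_ge\<close> leaves q >= hd/2 - 3hd/10.\<close>

theorem query_lower_bound:
  assumes alg: "good_alg n d p \<epsilon> M alg q"
    and slack: "10 * \<epsilon> * (opt_block + 2 * h) \<le> gap"
  shows "real q \<ge> h * d / 5"
proof -
  let ?x = "\<lambda>\<omega> J. answer (alg \<omega> A act) q J"
  define E where "E J = {\<omega> \<in> space M. guarantee n d p \<epsilon> A act (b J) (?x \<omega> J)}" for J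
  interpret prob_space M
    using alg by (simp add: good_alg_def)
  have "E J \<in> events \<and> prob (E J) \<ge> 4 / 5" for J
    using alg valid[of J] lip1_act unfolding good_alg_def E_def answer_def by blast
  then obtain \<omega> where \<omega>: "4 / 5 * card positions \<le> card {J \<in> positions. \<omega> \<in> E J}"
    using exists_in_many_events[OF finite_positions, of E "4 / 5"] by auto
  let ?w = "\<lambda>J. real (card (wrong J (?x \<omega> J)))"
  have "?w J \<le> d / 10 + (if \<omega> \<in> E J then 0 else real d)" if "J \<in> positions" for J
  proof (cases "\<omega> \<in> E J")
    case True
    then have "?w J * gap \<le> \<epsilon> * (d * (opt_block + 2 * h))"
      using that by (intro guarantee_imp_few_wrong) (simp_all add: E_def)
    also have "\<dots> \<le> d / 10 * gap"
      using mult_left_mono[OF slack, of "d / 10"] by (simp add: algebra_simps)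
    finally show ?thesis
      using True gap_pos by simp
  next
    case False
    then show ?thesis
      using card_wrong_le[of J "?x \<omega> J"] by simp
  qed
  then have "(\<Sum>J\<in>positions. ?w J) \<le> (\<Sum>J\<in>positions. d / 10 + (if \<omega> \<in> E J then 0 else real d))"
    by (intro sum_mono)
  also have "\<dots> = card positions * (d / 10) + real (card {J \<in> positions. \<omega> \<notin> E J}) * d"
    using finite_positions by (simp add: sum.distrib sum.If_cases Int_def)
  also have "\<dots> \<le> card positions * (d / 10) + card positions / 5 * d"
  proof -
    have "card positions = card {J \<in> positions. \<omega> \<in> E J} + card {J \<in> positions. \<omega> \<notin> E J}"
      using finite_positions
      by (subst card_Un_disjoint[symmetric]) (auto intro!: arg_cong[of _ _ card])
    with \<omega> have "real (card {J \<in> positions. \<omega> \<notin> E J}) \<le> card positions / 5"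
      by simp
    then show ?thesis
      by (intro add_left_mono mult_right_mono) auto
  qed
  finally have w: "(\<Sum>J\<in>positions. ?w J) \<le> card positions * (3 / 10 * d)"
    by (simp add: algebra_simps)
  have "real (d * h * card positions) \<le> real (2 * (\<Sum>J\<in>positions. h * card (wrong J (?x \<omega> J)) + q))"
    using sum_wrong_ge by (intro of_nat_mono)
  then have "d * h * real (card positions) \<le> 2 * (h * (\<Sum>J\<in>positions. ?w J) + card positions * q)"
    by (simp add: sum.distrib flip: sum_distrib_left)
  also have "\<dots> \<le> 2 * (h * (card positions * (3 / 10 * d)) + card positions * q)"
    by (intro mult_left_mono add_mono w) auto
  finally have "card positions * (d * h) \<le> card positions * (2 * (h * (3 / 10 * d) + q))"
    by (simp add: algebra_simps)
  moreover have "card positions > 0"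
    using finite_positions positions_nonempty by (simp add: card_gt_0_iff)
  ultimately show ?thesis
    by (simp add: field_simps)
qed

end

section \<open>Choice of the constants\<close>

theorem theorem3:
  fixes p :: real
  assumes "p > 2"
  shows "\<exists>c C. c > 0 \<and> C > 0 \<and> (\<exists>\<epsilon>0 > 0. \<forall>\<epsilon>. 0 < \<epsilon> \<and> \<epsilon> < \<epsilon>0 \<longrightarrow>
           (\<forall>n d. real n \<ge> C * real d / \<epsilon> powr p \<longrightarrow>
              (\<forall>M alg q. good_alg n d p \<epsilon> M alg q \<longrightarrow> real q \<ge> c * real d / \<epsilon> powr p)))"
proof -
  \<comment> \<open>\<sigma> is the product of \<epsilon> and s. The 70 is 10 from the slack
    condition times 7 from \<open>opt_block + 2 * h\<close> <= 3h + s^p <= 7 s^p; the factor (1/2)^p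
    matches \<open>gap_ge\<close>.\<close>
  define \<sigma> where "\<sigma> = (1 / 2) powr p / 70"
  have "\<sigma> > 0" by (simp add: \<sigma>_def)
  \<comment> \<open>The bound \<sigma>/3 on \<epsilon> ensures s >= 3, the 4 leaves room for d
    blocks of 2h <= 4 s^p rows, and the 1/5 comes from \<open>query_lower_bound\<close>.\<close>
  have "real q \<ge> \<sigma> powr p / 5 * real d / \<epsilon> powr p"
    if \<epsilon>: "0 < \<epsilon>" "\<epsilon> < \<sigma> / 3" and n: "real n \<ge> 4 * \<sigma> powr p * real d / \<epsilon> powr p"
      and alg: "good_alg n d p \<epsilon> M alg q" for \<epsilon> n d M alg q
  proof -
    define s where "s = \<sigma> / \<epsilon>"
    define h where "h = nat \<lceil>s powr p\<rceil>"
    have "s \<ge> 3"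
      using \<epsilon> by (simp add: s_def field_simps)
    have sp: "s powr p = \<sigma> powr p / \<epsilon> powr p"
      using \<epsilon> \<open>\<sigma> > 0\<close> by (simp add: s_def powr_divide)
    have "s powr p \<ge> 1"
      using \<open>s \<ge> 3\<close> assms by (intro ge_one_powr_ge_zero) auto
    \<comment> \<open>Rounding up at most doubles a number that is at least 1.\<close>
    have h: "s powr p \<le> h" "h \<le> 2 * s powr p"
      using \<open>s powr p \<ge> 1\<close> unfolding h_def by linarith+
    have "real (d * (2 * h)) \<le> real n"
    proof -
      have "d * (2 * real h) \<le> d * (4 * s powr p)"
        using h by (intro mult_left_mono) auto
      also have "\<dots> = 4 * \<sigma> powr p * real d / \<epsilon> powr p"
        by (simp add: sp)
      finally show ?thesis using n by simp
    qed
    then interpret hard_instance n d h p s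
      using h \<open>s powr p \<ge> 1\<close> \<open>s \<ge> 3\<close> assms by unfold_locales linarith+
    have "opt_block \<le> h + s powr p"
      unfolding opt_block_def using \<open>s \<ge> 3\<close> assms
      by (intro add_mono powr_mono2 mult_left_le powr_le1) auto
    then have "10 * \<epsilon> * (opt_block + 2 * h) \<le> 10 * \<epsilon> * (7 * s powr p)"
      using h \<epsilon> by (intro mult_left_mono) auto
    also have "s powr p = s * s powr (p - 1)"
      using \<open>s \<ge> 3\<close> powr_add[of s 1 "p - 1"] by simp
    also have "10 * \<epsilon> * (7 * (s * s powr (p - 1))) = (1 / 2) powr p * s powr (p - 1)"
      using \<epsilon> by (simp add: s_def \<sigma>_def)
    finally have "10 * \<epsilon> * (opt_block + 2 * h) \<le> gap"
      using gap_ge by linarith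
    then have "real q \<ge> h * d / 5"
      by (rule query_lower_bound[OF alg])
    moreover have "s powr p * real d \<le> real h * real d"
      using h by (intro mult_right_mono) auto
    ultimately show ?thesis
      by (simp add: sp)
  qed
  moreover have "\<sigma> powr p / 5 > 0" "4 * \<sigma> powr p > 0" "\<sigma> / 3 > 0"
    using \<open>\<sigma> > 0\<close> by auto
  ultimately show ?thesis by meson
qed

end
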